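(* If $p_n(\mathfrak{D},k)$ is the number of partitions of $k$ into distinct (positive) integers no greater than $n$, then $$(1+q^1)(1+q^2)(1+q^3)\cdots(1+q^n)=\sum_{k=0}^{\infty}p_n(\mathfrak{D},k)q^k=\cfrac{1}{1-\cfrac{q^1}{1+q^1-\cfrac{(1+q^1)q^2}{q^1+q^2+q^1q^2-\cfrac{(1+q^2)q^3}{q^2+q^3+q^2q^3-\ddots-\cfrac{(1+q^{n-1})q^n}{q^{n-1}+q^n+q^{n-1}q^n}}}}}.$$
   Formalization: The partial numerators (1+q^{k-1})q^k with k ≥ 3 are replaced by q^{k-2}(1+q^{k-1})q^k, since the printed identity fails (n=3, q=2 gives 25, not 135); for numeric q, equality with the fraction is claimed where no denominator vanishes. *)

theory Defs
  imports "HOL-Analysis.Analysis" "HOL-Computational_Algebra.Formal_Laurent_Series"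
    "HOL-Library.Multiset"
begin

definition partitions :: "nat \<Rightarrow> nat multiset set" where
  "partitions k = {M. 0 \<notin># M \<and> sum_mset M = k}"

definition p_distinct :: "nat \<Rightarrow> nat \<Rightarrow> nat" where
  "p_distinct n k =
     card {M \<in> partitions k. (\<forall>x. count M x \<le> 1) \<and> (\<forall>x\<in>#M. x \<le> n)}"

text \<open>
  \<open>cf_denom a b k m\<close> is the finite continued fraction with \<open>m\<close> divisions
  \<open>b k - a (k+1) / (b (k+1) - a (k+2) / (b (k+2) - ... - a (k+m) / b (k+m)))\<close>.
\<close>

fun cf_denom :: "(nat \<Rightarrow> 'a::field) \<Rightarrow> (nat \<Rightarrow> 'a) \<Rightarrow> nat \<Rightarrow> nat \<Rightarrow> 'a" where
  "cf_denom a b k 0 = b k"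
| "cf_denom a b k (Suc m) = b k - a (Suc k) / cf_denom a b (Suc k) m"

text \<open>
  The continued fraction is Euler's, for the series with the terms \<open>t 0 = 1\<close> and
  \<open>t k = (1 + q) * ... * (1 + q ^ (k-1)) * q ^ k\<close>, whose sum up to \<open>n\<close> telescopes to
  the product. The ratio \<open>t k / t (k-1)\<close> is \<open>(1 + q ^ (k-1)) * q ^ k / q ^ (k-1)\<close> for
  \<open>k \<ge> 2\<close>; clearing the denominator \<open>q ^ (k-1)\<close> at level \<open>k\<close> and \<open>q ^ (k-2)\<close> at the level
  above it gives the partial numerator \<open>q ^ (k-2) * (1 + q ^ (k-1)) * q ^ k\<close>.
  The factor \<open>q ^ (k-2)\<close>, which is 1 for \<open>k = 2\<close>, is missing from the printed source for
  \<open>k \<ge> 3\<close>. Without it the identity fails for every \<open>n \<ge> 3\<close>: for \<open>n = 3\<close> and \<open>q = 2\<close>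
  the fraction is 25 and the product is 135.
\<close>

definition euler_num :: "'a::field \<Rightarrow> nat \<Rightarrow> 'a" where
  "euler_num q k =
     (if k = 1 then q else q ^ (k - 2) * ((1 + q ^ (k - 1)) * q ^ k))"

definition euler_den :: "'a::field \<Rightarrow> nat \<Rightarrow> 'a" where
  "euler_den q k =
     (if k = 0 then 1 else if k = 1 then 1 + q
      else q ^ (k - 1) + q ^ k + q ^ (k - 1) * q ^ k)"

definition euler_cf :: "nat \<Rightarrow> 'a::field \<Rightarrow> 'a" where
  "euler_cf n q = 1 / cf_denom (euler_num q) (euler_den q) 0 n"

text \<open>No division by zero occurs when the continued fraction is evaluated.\<close>

definition euler_cf_defined :: "nat \<Rightarrow> 'a::field \<Rightarrow> bool" where
  "euler_cf_defined n q \<longleftrightarrow>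
     (\<forall>k\<le>n. cf_denom (euler_num q) (euler_den q) k (n - k) \<noteq> 0)"

end

theory Submission
  imports Defs
begin

text \<open>
  The first equality is the usual generating-function argument: a partition into distinct parts
  no greater than \<open>n\<close> is a subset of \<open>{1..n}\<close>, and expanding the product gives one
  monomial \<open>q\<close> to the sum of \<open>S\<close> for each such subset \<open>S\<close>
  (\<open>prod_one_plus_power_eq\<close>).

  The second is Euler's way of turning a sum of products into a continued fraction. Let
  \<open>r 1, r 2, ...\<close> be given and let
  \<open>T k = 1 + r (k+1) + r (k+1) * r (k+2) + ... + r (k+1) * ... * r n\<close>, so that
  \<open>T k = 1 + r (k+1) * T (k+1)\<close>. The quotients \<open>E k = T (k-1) / T k = r k + 1 / T k\<close>
  satisfy \<open>E k = 1 + r k - r (k+1) / E (k+1)\<close>, because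
  \<open>r (k+1) / E (k+1) = (T k - 1) / T k\<close>. Hence they are the successive denominators of the
  continued fraction with partial numerators \<open>r k\<close> and partial denominators \<open>1 + r k\<close>, and the
  outermost one is \<open>1 / T 0\<close>. Scaling level \<open>k\<close> by a factor \<open>c k\<close> clears fractions
  (\<open>cf_denom_times_ratio_sum\<close>).

  Here \<open>r 1 = q\<close>, \<open>r k = (1 + q ^ (k-1)) * q\<close> for \<open>k \<ge> 2\<close>, and \<open>c k = q ^ (k-1)\<close>.
  The terms of \<open>T 0\<close> after the leading \<open>1\<close> are then \<open>(1 + q) * ... * (1 + q ^ (k-1)) * q ^ k\<close>, the difference
  of two consecutive partial products, so \<open>T 0\<close> telescopes to the full product
  (\<open>ratio_sum_euler_ratio\<close>).

  The argument is stated for multiplied-out quotients, so over the complex numbers it asks for no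
  more than that the denominators of the fraction be nonzero. For formal Laurent series that is a
  fact: every \<open>T k\<close> is a power series and \<open>r k\<close> one without constant term, so
  \<open>1 + r k * T k\<close> has constant term \<open>1\<close>. Since \<open>c k\<close> is nonzero too, so is the product
  \<open>c k * (1 + r k * T k)\<close> of \<open>T k\<close> with the denominator at level \<open>k\<close>.
\<close>

section \<open>Euler's continued fraction\<close>

text \<open>
  The sum \<open>T k\<close> of the introduction for \<open>n = k + m\<close>, in the recursive form that matches the
  unfolding of \<^const>\<open>cf_denom\<close>; as there, \<open>m\<close> counts the levels below \<open>k\<close>.
\<close>

fun ratio_sum :: "(nat \<Rightarrow> 'a::comm_ring_1) \<Rightarrow> nat \<Rightarrow> nat \<Rightarrow> 'a" where
  "ratio_sum r k 0 = 1"
| "ratio_sum r k (Suc m) = 1 + r (Suc k) * ratio_sum r (Suc k) m"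

text \<open>
  With the scaling factors \<open>c i = 1\<close>, this is \<open>E k = r k + 1 / T k\<close> multiplied by \<open>T k\<close>. In this
  form no \<open>T k\<close> has to be known to be nonzero; if \<open>r 0 = 0\<close> and \<open>c 0 = 1\<close>, the case \<open>k = 0\<close> says
  that the denominator of the whole fraction and \<open>T 0\<close> are inverse to each other.
\<close>

lemma cf_denom_times_ratio_sum:
  fixes a b c r :: "nat \<Rightarrow> 'a::field"
  assumes a: "\<And>i. a (Suc i) = c i * c (Suc i) * r (Suc i)"
    and b: "\<And>i. b i = c i * (1 + r i)"
    and "\<And>j. 0 < j \<Longrightarrow> j \<le> m \<Longrightarrow> cf_denom a b (k + j) (m - j) \<noteq> 0"
  shows "cf_denom a b k m * ratio_sum r k m = c k * (1 + r k * ratio_sum r k m)"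
  using assms(3)
proof (induction m arbitrary: k)
  case 0
  then show ?case by (simp add: b)
next
  case (Suc m)
  define D where "D = cf_denom a b (Suc k) m"
  define T where "T = ratio_sum r (Suc k) m"
  have "D \<noteq> 0"
    using Suc.prems[of 1] by (simp add: D_def)
  have "cf_denom a b (Suc k + j) (m - j) \<noteq> 0" if "0 < j" "j \<le> m" for j
    using Suc.prems[of "Suc j"] that by simp
  then have DT: "D * T = c (Suc k) * (1 + r (Suc k) * T)"
    unfolding D_def T_def by (rule Suc.IH)
  have "a (Suc k) / D * (1 + r (Suc k) * T) = c k * r (Suc k) * (D * T) / D"
    unfolding DT by (simp add: a)
  also have "\<dots> = c k * r (Suc k) * T"
    using \<open>D \<noteq> 0\<close> by simp
  finally have "a (Suc k) / D * (1 + r (Suc k) * T) = c k * r (Suc k) * T" .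
  then have "(b k - a (Suc k) / D) * (1 + r (Suc k) * T)
      = c k * (1 + r k) * (1 + r (Suc k) * T) - c k * r (Suc k) * T"
    by (simp only: left_diff_distrib b)
  also have "\<dots> = c k * (1 + r k * (1 + r (Suc k) * T))"
    by (simp add: algebra_simps)
  finally show ?case
    by (simp add: D_def T_def)
qed

lemma cf_denom_nonzero:
  fixes a b c r :: "nat \<Rightarrow> 'a::field"
  assumes a: "\<And>i. a (Suc i) = c i * c (Suc i) * r (Suc i)"
    and b: "\<And>i. b i = c i * (1 + r i)"
    and c: "\<And>i. c i \<noteq> 0"
    and r: "\<And>i l. 1 + r i * ratio_sum r i l \<noteq> 0"
  shows "cf_denom a b k m \<noteq> 0"
proof (induction m arbitrary: k rule: less_induct)
  case (less m)
  \<comment> \<open>The denominators inside this one are nonzero by induction.\<close>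
  have "cf_denom a b k m * ratio_sum r k m = c k * (1 + r k * ratio_sum r k m)"
    by (rule cf_denom_times_ratio_sum[where c = c]) (simp_all only: a b, simp add: less.IH)
  then show ?case
    using c[of k] r[of k m] by auto
qed

section \<open>The fraction for the product\<close>

text \<open>
  The value \<open>0\<close> at index \<open>0\<close> makes \<open>1 + r 0 = 1\<close> the outermost partial denominator.
  The truncated exponent in \<open>q ^ (k - 1)\<close> below likewise gives level \<open>0\<close> the scaling factor
  \<open>1\<close>.
\<close>

definition euler_ratio :: "'a::comm_ring_1 \<Rightarrow> nat \<Rightarrow> 'a" where
  "euler_ratio q k =
     (if k = 0 then 0 else if k = 1 then q else (1 + q ^ (k - 1)) * q)"

lemma euler_num_eq:
  "euler_num q (Suc k) = q ^ (k - 1) * q ^ (Suc k - 1) * euler_ratio q (Suc k)"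
  by (cases k) (auto simp: euler_num_def euler_ratio_def algebra_simps)

lemma euler_den_eq: "euler_den q k = q ^ (k - 1) * (1 + euler_ratio q k)"
  by (cases k) (auto simp: euler_den_def euler_ratio_def algebra_simps)

text \<open>
  Multiplied by the term \<open>(1 + q) * ... * (1 + q ^ k) * q ^ (k+1)\<close> of the series, the sum of
  ratios becomes the sum of the terms from that one on, and this telescopes.
\<close>

lemma ratio_sum_euler_ratio_tail:
  "(\<Prod>i=1..k. 1 + q ^ i) * q ^ Suc k * ratio_sum (euler_ratio q) (Suc k) m
     = (\<Prod>i=1..Suc (k + m). 1 + q ^ i) - (\<Prod>i=1..k. 1 + q ^ i)"
proof (induction m arbitrary: k)
  case 0
  show ?case by (simp add: algebra_simps)
next
  case (Suc m)
  define P where "P = (\<Prod>i=1..k. 1 + q ^ i)"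
  define T where "T = ratio_sum (euler_ratio q) (Suc (Suc k)) m"
  have ratio: "euler_ratio q (Suc (Suc k)) = (1 + q ^ Suc k) * q"
    by (simp add: euler_ratio_def)
  have IH: "P * (1 + q ^ Suc k) * q ^ Suc (Suc k) * T
      = (\<Prod>i=1..Suc (k + Suc m). 1 + q ^ i) - P * (1 + q ^ Suc k)"
    using Suc.IH[of "Suc k"] by (simp add: P_def T_def)
  have "P * q ^ Suc k * (1 + (1 + q ^ Suc k) * q * T)
      = P * q ^ Suc k + P * (1 + q ^ Suc k) * q ^ Suc (Suc k) * T"
    by (simp add: algebra_simps)
  also have "\<dots> = (\<Prod>i=1..Suc (k + Suc m). 1 + q ^ i) - P"
    unfolding IH by (simp add: algebra_simps)
  finally show ?case
    by (simp only: ratio_sum.simps ratio P_def T_def)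
qed

lemma ratio_sum_euler_ratio: "ratio_sum (euler_ratio q) 0 n = (\<Prod>i=1..n. 1 + q ^ i)"
proof (cases n)
  case (Suc m)
  then show ?thesis
    using ratio_sum_euler_ratio_tail[where k = 0 and q = q and m = m] by (simp add: euler_ratio_def)
qed simp

lemma euler_cf_eq_prod:
  assumes "euler_cf_defined n q"
  shows "euler_cf n q = (\<Prod>i=1..n. 1 + q ^ i)"
proof -
  have nz: "cf_denom (euler_num q) (euler_den q) j (n - j) \<noteq> 0" if "j \<le> n" for j
    using assms that by (simp add: euler_cf_defined_def)
  have "cf_denom (euler_num q) (euler_den q) 0 n * ratio_sum (euler_ratio q) 0 n
      = q ^ (0 - 1) * (1 + euler_ratio q 0 * ratio_sum (euler_ratio q) 0 n)"
    by (rule cf_denom_times_ratio_sum[where c = "\<lambda>k. q ^ (k - 1)"])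
      (use nz in \<open>auto simp only: euler_num_eq euler_den_eq add_0\<close>)
  then show ?thesis
    using nz[of 0]
    by (simp add: euler_cf_def ratio_sum_euler_ratio euler_ratio_def field_simps)
qed

lemma ratio_sum_fls_X:
  "ratio_sum (euler_ratio (fls_X :: 'a::comm_ring_1 fls)) k m
     = fps_to_fls (ratio_sum (euler_ratio fps_X) k m)"
  by (induction m arbitrary: k)
    (simp_all add: euler_ratio_def fls_times_fps_to_fls fps_to_fls_power)

lemma euler_cf_defined_fls_X: "euler_cf_defined n (fls_X :: 'a::field fls)"
proof -
  have "1 + euler_ratio fls_X k * ratio_sum (euler_ratio fls_X) k m \<noteq> (0 :: 'a fls)" for k m
  proof -
    define f :: "'a fps" where "f = 1 + euler_ratio fps_X k * ratio_sum (euler_ratio fps_X) k m"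
    have "fps_nth f 0 = 1"
      by (simp add: f_def euler_ratio_def)
    then have "fps_to_fls f \<noteq> 0"
      by auto
    then show ?thesis
      by (simp add: f_def ratio_sum_fls_X euler_ratio_def fls_times_fps_to_fls fps_to_fls_power
          split: if_splits)
  qed
  then have "cf_denom (euler_num fls_X) (euler_den fls_X) k m \<noteq> (0 :: 'a fls)" for k m
    by (intro cf_denom_nonzero[where c = "\<lambda>k. fls_X ^ (k - 1)" and r = "euler_ratio fls_X"]
        euler_num_eq euler_den_eq) auto
  then show ?thesis
    by (simp add: euler_cf_defined_def)
qed

section \<open>The generating function\<close>

lemma p_distinct_eq_card_subsets: "p_distinct n k = card {S \<in> Pow {1..n}. \<Sum>S = k}"
proof -
  let ?M = "{M \<in> partitions k. (\<forall>x. count M x \<le> 1) \<and> (\<forall>x\<in>#M. x \<le> n)}"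
  have mset_set_set_mset: "mset_set (set_mset M) = M" if "\<And>x. count M x \<le> 1" for M :: "nat multiset"
  proof (rule multiset_eqI)
    show "count (mset_set (set_mset M)) x = count M x" for x
      using that[of x] by (cases "count M x") (auto simp: count_mset_set' not_in_iff)
  qed
  have sum_mset_set: "sum_mset (mset_set S) = \<Sum>S" for S :: "nat set"
    by (simp add: sum_unfold_sum_mset)
  have "bij_betw mset_set {S \<in> Pow {1..n}. \<Sum>S = k} ?M"
  proof (rule bij_betw_byWitness[where f' = set_mset])
    show "\<forall>S\<in>{S \<in> Pow {1..n}. \<Sum>S = k}. set_mset (mset_set S) = S"
      by (metis (lifting) CollectD PowD finite_atLeastAtMost finite_set_mset_mset_set finite_subset)
    show "\<forall>M\<in>?M. mset_set (set_mset M) = M"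
      by (simp add: mset_set_set_mset)
    show "mset_set ` {S \<in> Pow {1..n}. \<Sum>S = k} \<subseteq> ?M"
    proof clarify
      fix S assume S: "S \<subseteq> {1..n}" and k: "k = \<Sum>S"
      have "finite S"
        using S by (rule finite_subset) simp
      moreover have "0 \<notin> S" "\<forall>x\<in>S. x \<le> n"
        using S by auto
      ultimately show "mset_set S \<in> partitions (\<Sum>S) \<and> (\<forall>x. count (mset_set S) x \<le> 1)
          \<and> (\<forall>x\<in>#mset_set S. x \<le> n)"
        by (simp add: partitions_def sum_mset_set count_mset_set')
    qed
    show "set_mset ` ?M \<subseteq> {S \<in> Pow {1..n}. \<Sum>S = k}"
    proof clarify
      fix M assume M: "M \<in> partitions k" "\<forall>x. count M x \<le> 1" "\<forall>x\<in>#M. x \<le> n"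
      have "\<Sum>(set_mset M) = k"
        using M sum_mset_set[of "set_mset M"] by (simp add: mset_set_set_mset partitions_def)
      moreover have "set_mset M \<subseteq> {1..n}"
        using M by (force simp: partitions_def Suc_le_eq intro: gr0I)
      ultimately show "set_mset M \<in> Pow {1..n} \<and> \<Sum>(set_mset M) = k"
        by simp
    qed
  qed
  then show ?thesis
    unfolding p_distinct_def by (rule bij_betw_same_card[symmetric])
qed

lemma sum_subset_le: "S \<subseteq> {1..n} \<Longrightarrow> \<Sum>S \<le> \<Sum>{1..n::nat}"
  by (rule sum_mono2) auto

lemma p_distinct_eq_0:
  assumes "\<Sum>{1..n} < k"
  shows "p_distinct n k = 0"
proof -
  have "\<Sum>S \<noteq> k" if "S \<subseteq> {1..n}" for S
    using sum_subset_le[OF that] assms by linarith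
  then have "{S \<in> Pow {1..n}. \<Sum>S = k} = {}"
    by blast
  then show ?thesis
    by (simp only: p_distinct_eq_card_subsets card.empty)
qed

lemma prod_one_plus_power_eq:
  fixes q :: "'a::comm_ring_1"
  shows "(\<Prod>i=1..n. 1 + q ^ i) = (\<Sum>k\<le>\<Sum>{1..n}. of_nat (p_distinct n k) * q ^ k)"
proof -
  have "(\<Prod>i=1..n. 1 + q ^ i) = (\<Prod>i=1..n. q ^ i + 1)"
    by (simp add: add.commute)
  also have "\<dots> = (\<Sum>S\<in>Pow {1..n}. q ^ \<Sum>S)"
    by (simp add: prod_add power_sum)
  also have "\<dots> = (\<Sum>k\<le>\<Sum>{1..n}. of_nat (p_distinct n k) * q ^ k)"
    unfolding p_distinct_eq_card_subsets
    by (rule sum_fun_comp) (use sum_subset_le in auto)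
  finally show ?thesis .
qed

lemma p_distinct_sums:
  fixes q :: "'a::{comm_ring_1, real_normed_vector}"
  shows "(\<lambda>k. of_nat (p_distinct n k) * q ^ k) sums (\<Prod>i=1..n. 1 + q ^ i)"
  unfolding prod_one_plus_power_eq
  by (rule sums_finite) (auto simp: p_distinct_eq_0)

lemma prod_one_plus_fps_X:
  "(\<Prod>i=1..n. 1 + fps_X ^ i) = Abs_fps (\<lambda>k. of_nat (p_distinct n k) :: 'a::comm_ring_1)"
proof (rule fps_ext)
  fix j
  have "fps_nth (\<Prod>i=1..n. 1 + fps_X ^ i) j
      = (\<Sum>k\<le>\<Sum>{1..n}. if j = k then of_nat (p_distinct n k) else (0::'a))"
    unfolding prod_one_plus_power_eq fps_sum_nth fps_mult_of_nat_nth fps_X_power_nth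
    by (intro sum.cong) auto
  also have "\<dots> = of_nat (p_distinct n j)"
    by (auto simp: p_distinct_eq_0)
  finally show "fps_nth (\<Prod>i=1..n. 1 + fps_X ^ i) j
      = fps_nth (Abs_fps (\<lambda>k. of_nat (p_distinct n k) :: 'a)) j"
    by simp
qed

lemma prod_one_plus_fls_X:
  "(\<Prod>i=1..n. 1 + fls_X ^ i)
     = fps_to_fls (Abs_fps (\<lambda>k. of_nat (p_distinct n k) :: 'a::comm_ring_1))"
proof -
  have "fps_to_fls (\<Prod>i=1..n. 1 + fps_X ^ i) = (\<Prod>i=1..n. 1 + fls_X ^ i :: 'a fls)"
    by (induction n) (simp_all add: fls_times_fps_to_fls fps_to_fls_power)
  then show ?thesis
    unfolding prod_one_plus_fps_X by (rule sym)
qed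

theorem corollary2p2:
  fixes n :: nat
  shows
    "((\<Prod>i=1..n. 1 + fls_X ^ i)
         = fps_to_fls (Abs_fps (\<lambda>k. of_nat (p_distinct n k) :: complex))
      \<and> euler_cf_defined n (fls_X :: complex fls)
      \<and> fps_to_fls (Abs_fps (\<lambda>k. of_nat (p_distinct n k) :: complex)) = euler_cf n fls_X)
     \<and> (\<forall>q::complex.
          (\<lambda>k. of_nat (p_distinct n k) * q ^ k) sums (\<Prod>i=1..n. 1 + q ^ i)
          \<and> (euler_cf_defined n q \<longrightarrow>
               (\<Sum>k. of_nat (p_distinct n k) * q ^ k) = euler_cf n q))"
proof (intro conjI allI impI)
  show "(\<Prod>i=1..n. 1 + fls_X ^ i)
      = fps_to_fls (Abs_fps (\<lambda>k. of_nat (p_distinct n k) :: complex))"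
    by (rule prod_one_plus_fls_X)
  show "euler_cf_defined n (fls_X :: complex fls)"
    by (rule euler_cf_defined_fls_X)
  show "fps_to_fls (Abs_fps (\<lambda>k. of_nat (p_distinct n k) :: complex)) = euler_cf n fls_X"
    by (simp only: euler_cf_eq_prod[OF euler_cf_defined_fls_X] prod_one_plus_fls_X)
next
  fix q :: complex
  show "(\<lambda>k. of_nat (p_distinct n k) * q ^ k) sums (\<Prod>i=1..n. 1 + q ^ i)"
    by (rule p_distinct_sums)
  then show "(\<Sum>k. of_nat (p_distinct n k) * q ^ k) = euler_cf n q" if "euler_cf_defined n q"
    using that by (simp add: euler_cf_eq_prod sums_iff)
qed

end
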